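(* For every $\varepsilon>0$ there exists an instance $\mathcal{I}$ of the Square Strip Packing Problem such that $$\frac{h_{\text{BL}}^{\text{best}}(\mathcal{I})}{h_{\text{OPT}}(\mathcal{I})}\ \ge\ \frac43-\varepsilon .$$ That is, the approximation ratio of the bottom-left algorithm for the Square Strip Packing Problem cannot be better than $4/3-\varepsilon$, even if the squares are ordered in the best possible way.
   Context: Strip Packing Problem (SPP): given a strip width $W>0$ and rectangles $r_1,\dots,r_n$ with widths $w_i\le W$ and heights $h_i$, a packing assigns to each $r_i$ a lower-left corner $(x_i,y_i)$; it is feasible if $x_i\ge 0$, $x_i+w_i\le W$, $y_i\ge 0$ for all $i$, and the open rectangles $(x_i,x_i+w_i)\times(y_i,y_i+h_i)$ are pairwise disjoint. Rotations are not allowed. The height of a packing is $\max_i (y_i+h_i)$, and $h_{\text{OPT}}(\mathcal{I})$ is the minimum height of a feasible packing. The Square Strip Packing Problem (SSPP) is the special case where all rectangles are squares. Bottom-left algorithm: given an ordering $r_1,\dots,r_n$, place $r_1$ at $(0,0)$. Then, for $i=2,\dots,n$, place $r_i$ at a position $(x_i,y_i)$ such that the first $i$ rectangles form a feasible packing and $(y_i,x_i)$ is lexicographically minimal among all such positions (lowest position, leftmost in case of ties). $h_{\text{BL}}^{\text{best}}(\mathcal{I})$ denotes the minimum, over all $n!$ orderings, of the height of the packing produced by the bottom-left algorithm. *)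

theory Defs
  imports Complex_Main "HOL-Library.Multiset"
begin

(* A rectangle is a pair (w, h) of width and height; a position is the
   lower-left corner (x, y). *)
type_synonym rect = "real \<times> real"
type_synonym point = "real \<times> real"

definition open_rect :: "point \<Rightarrow> rect \<Rightarrow> (real \<times> real) set" where
  "open_rect p r = {(a, b). fst p < a \<and> a < fst p + fst r \<and> snd p < b \<and> b < snd p + snd r}"

definition in_strip :: "real \<Rightarrow> point \<Rightarrow> rect \<Rightarrow> bool" where
  "in_strip W p r \<longleftrightarrow> 0 \<le> fst p \<and> fst p + fst r \<le> W \<and> 0 \<le> snd p"

definition feasible_packing :: "real \<Rightarrow> rect list \<Rightarrow> (nat \<Rightarrow> point) \<Rightarrow> bool" where
  "feasible_packing W rs pos \<longleftrightarrow>
     (\<forall>i < length rs. in_strip W (pos i) (rs ! i)) \<and>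
     (\<forall>i < length rs. \<forall>j < length rs. i \<noteq> j \<longrightarrow>
         open_rect (pos i) (rs ! i) \<inter> open_rect (pos j) (rs ! j) = {})"

definition packing_height :: "rect list \<Rightarrow> (nat \<Rightarrow> point) \<Rightarrow> real" where
  "packing_height rs pos = Max ((\<lambda>i. snd (pos i) + snd (rs ! i)) ` {..<length rs})"

definition h_opt :: "real \<Rightarrow> rect list \<Rightarrow> real" where
  "h_opt W rs = Inf {packing_height rs pos | pos. feasible_packing W rs pos}"

definition valid_next :: "real \<Rightarrow> (point \<times> rect) list \<Rightarrow> rect \<Rightarrow> point \<Rightarrow> bool" where
  "valid_next W placed r p \<longleftrightarrow> in_strip W p r \<and>
     (\<forall>(q, s) \<in> set placed. open_rect q s \<inter> open_rect p r = {})"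

definition yx_lex_le :: "point \<Rightarrow> point \<Rightarrow> bool" where
  "yx_lex_le p q \<longleftrightarrow> snd p < snd q \<or> (snd p = snd q \<and> fst p \<le> fst q)"

definition bl_next :: "real \<Rightarrow> (point \<times> rect) list \<Rightarrow> rect \<Rightarrow> point" where
  "bl_next W placed r =
     (if placed = [] then (0, 0)
      else (THE p. valid_next W placed r p \<and> (\<forall>q. valid_next W placed r q \<longrightarrow> yx_lex_le p q)))"

primrec bl_go :: "real \<Rightarrow> (point \<times> rect) list \<Rightarrow> rect list \<Rightarrow> (point \<times> rect) list" where
  "bl_go W placed [] = placed"
| "bl_go W placed (r # rs) = bl_go W (placed @ [(bl_next W placed r, r)]) rs"

definition h_bl :: "real \<Rightarrow> rect list \<Rightarrow> real" where
  "h_bl W rs = Max ((\<lambda>(p, r). snd p + snd r) ` set (bl_go W [] rs))"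

definition h_bl_best :: "real \<Rightarrow> rect list \<Rightarrow> real" where
  "h_bl_best W rs = Min (h_bl W ` {qs. mset qs = mset rs})"

definition sspp_instance :: "real \<Rightarrow> real list \<Rightarrow> bool" where
  "sspp_instance W ss \<longleftrightarrow> 0 < W \<and> ss \<noteq> [] \<and> (\<forall>s \<in> set ss. 0 < s \<and> s \<le> W)"

definition squares :: "real list \<Rightarrow> rect list" where
  "squares ss = map (\<lambda>s. (s, s)) ss"

end

theory Submission
  imports Defs "HOL-Analysis.Analysis" "HOL-Combinatorics.List_Permutation"
begin

text \<open>
  For small \<open>d\<close> take two squares of side \<open>2 - 3d\<close>, two of side \<open>2 + 2d\<close>, one square \<open>z\<close> of side
  \<open>1 + d\<close> and ten unit squares, in a strip of width \<open>9 - d\<close>. They fit into height \<open>3 + 2d\<close>. If a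
  bottom-left packing had height below \<open>4 - 6d\<close>, every square would start near height 0, 1 or 2,
  so the lines at heights 1/2, 3/2 and 5/2 together would meet total width three times the strip
  width; hence each of these rows is full. This forces the bottom row to be \<open>p1\<close>, \<open>p2\<close> (sides
  \<open>2 - 3d\<close>, \<open>2 + 2d\<close>) and five units, the middle row to be all large squares and \<open>z\<close>, and the top
  row to be \<open>q1\<close>, \<open>q2\<close> and five units. The tops of \<open>p1\<close>, \<open>z\<close>, \<open>p2\<close> are at the increasing heights
  \<open>2 - 3d\<close>, \<open>2 + d\<close>, \<open>2 + 2d\<close>, so the first unit of the top row goes to the left end of \<open>p1\<close>, and
  the second one, no longer fitting on \<open>p1\<close>, goes to height \<open>2 + d\<close>. A vertical line that crosses
  no square of two full rows cuts off equal widths from both, and as \<open>d\<close> is small this is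
  impossible unless the multiples of \<open>d\<close> cancel. These cancellations rule out every position of
  the second unit.
\<close>

section \<open>Rows of a packing\<close>

text \<open>Induction by left end: the interval starting last lies to the right of all others, so
  these fit between \<open>a\<close> and its left end. Hence \<open>b\<close> has to vary.\<close>

lemma sum_separated_intervals_le:
  fixes x l :: "'a \<Rightarrow> real"
  assumes "finite A"
    and "\<And>i. i \<in> A \<Longrightarrow> 0 < l i"
    and "\<And>i. i \<in> A \<Longrightarrow> a \<le> x i \<and> x i + l i \<le> b"
    and "\<And>i j. i \<in> A \<Longrightarrow> j \<in> A \<Longrightarrow> i \<noteq> j \<Longrightarrow> x i + l i \<le> x j \<or> x j + l j \<le> x i"
    and "a \<le> b"
  shows "sum l A \<le> b - a"
  using assms
proof (induction A arbitrary: b rule: finite_ranking_induct[where f = x])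
  case empty
  then show ?case by simp
next
  case (insert e S)
  show ?case
  \<comment> \<open>The ranking induction does not guarantee that \<open>e\<close> is new to
    \<open>S\<close>.\<close>
  proof (cases "e \<in> S")
    case True
    then have "insert e S = S" by auto
    then show ?thesis using insert.IH[of b] insert.prems by simp
  next
    case False
    have "x j + l j \<le> x e" if "j \<in> S" for j
      using insert.prems(3)[of e j] insert.prems(1)[of e] insert.hyps(2)[OF that] that False by force
    then have "sum l S \<le> x e - a"
      using insert.prems by (intro insert.IH) auto
    then show ?thesis
      using insert.prems(2)[of e] insert.hyps(1) False by simp
  qed
qed

text \<open>The outcome of the algorithm as plain inequalities. \<open>\<tau>\<close> is the time of
  placement; in \<open>bottom_left\<close>, \<open>(u, v)\<close> is a competing position for
  \<open>i\<close>, tested only against the squares placed earlier.\<close>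

locale bl_packing =
  fixes W :: real and I :: "'a set" and s x y :: "'a \<Rightarrow> real" and \<tau> :: "'a \<Rightarrow> nat"
  assumes finite_I: "finite I"
    and inj_time: "inj_on \<tau> I"
    and size_pos: "i \<in> I \<Longrightarrow> 0 < s i"
    and x_nonneg: "i \<in> I \<Longrightarrow> 0 \<le> x i"
    and x_le: "i \<in> I \<Longrightarrow> x i + s i \<le> W"
    and y_nonneg: "i \<in> I \<Longrightarrow> 0 \<le> y i"
    and separated: "i \<in> I \<Longrightarrow> j \<in> I \<Longrightarrow> i \<noteq> j \<Longrightarrow>
        x i + s i \<le> x j \<or> x j + s j \<le> x i \<or> y i + s i \<le> y j \<or> y j + s j \<le> y i"
    and bottom_left: "i \<in> I \<Longrightarrow> 0 \<le> u \<Longrightarrow> u + s i \<le> W \<Longrightarrow> 0 \<le> v \<Longrightarrow>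
        (\<And>j. j \<in> I \<Longrightarrow> \<tau> j < \<tau> i \<Longrightarrow>
          x j + s j \<le> u \<or> u + s i \<le> x j \<or> y j + s j \<le> v \<or> v + s i \<le> y j) \<Longrightarrow>
        y i < v \<or> y i = v \<and> x i \<le> u"
begin

text \<open>Otherwise the square could slide straight down to the highest earlier top below it, or
  to the floor, against minimality.\<close>

lemma supported:
  assumes i: "i \<in> I" and "y i \<noteq> 0"
  obtains j where "j \<in> I" "\<tau> j < \<tau> i" "y i = y j + s j"
proof -
  \<comment> \<open>The element 0 stands for the floor of the strip.\<close>
  define T where "T = insert 0 ((\<lambda>j. y j + s j) ` {j \<in> I. \<tau> j < \<tau> i \<and> y j + s j \<le> y i})"
  have fin: "finite T" "T \<noteq> {}" using finite_I by (auto simp: T_def)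
  define v where "v = Max T"
  have vT: "v \<in> T" using fin by (simp add: v_def)
  have v0: "0 \<le> v" using fin by (simp add: v_def T_def)
  have vle: "v \<le> y i" using vT y_nonneg[OF i] by (auto simp: T_def)
  have "y i < v \<or> y i = v \<and> x i \<le> x i"
  proof (rule bottom_left[OF i x_nonneg[OF i] x_le[OF i] v0])
    fix j assume j: "j \<in> I" "\<tau> j < \<tau> i"
    have "y j + s j \<le> v" if "y j + s j \<le> y i"
      using fin that j by (auto simp: v_def T_def)
    then show "x j + s j \<le> x i \<or> x i + s i \<le> x j \<or> y j + s j \<le> v \<or> v + s i \<le> y j"
      using separated[OF j(1) i] j vle by force
  qed
  then have "y i = v" using vle by auto
  then show thesis using vT \<open>y i \<noteq> 0\<close> that by (auto simp: T_def)
qed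

lemma row_separated:
  assumes "i \<in> I" "j \<in> I" "i \<noteq> j"
    and "y i < c" "c < y i + s i" "y j < c" "c < y j + s j"
  shows "x i + s i \<le> x j \<or> x j + s j \<le> x i"
  using separated[OF assms(1-3)] assms by auto

lemma row_sum_between:
  assumes "A \<subseteq> I" and "\<And>i. i \<in> A \<Longrightarrow> y i < c \<and> c < y i + s i"
    and "\<And>i. i \<in> A \<Longrightarrow> a \<le> x i \<and> x i + s i \<le> b" "a \<le> b"
  shows "sum s A \<le> b - a"
proof (rule sum_separated_intervals_le[where x = x])
  show "finite A" using assms(1) finite_I finite_subset by blast
  show "0 < s i" if "i \<in> A" for i using that assms(1) size_pos by blast
  show "x i + s i \<le> x j \<or> x j + s j \<le> x i" if "i \<in> A" "j \<in> A" "i \<noteq> j" for i j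
    using that assms(1) assms(2)[OF that(1)] assms(2)[OF that(2)] row_separated[of i j c] by blast
qed (use assms in auto)

lemma row_sum_le:
  assumes "A \<subseteq> I" "\<And>i. i \<in> A \<Longrightarrow> y i < c \<and> c < y i + s i" "0 \<le> W"
  shows "sum s A \<le> W"
  using row_sum_between[of A c 0 W] assms x_nonneg x_le by auto

text \<open>The squares left of the gap have total width at most \<open>u\<close>, those right of it
  at most \<open>W - v\<close>. Together they have width \<open>W\<close>, so both bounds are
  attained and the gap is empty.\<close>

lemma full_row_gap:
  assumes A: "A \<subseteq> I" "\<And>i. i \<in> A \<Longrightarrow> y i < c \<and> c < y i + s i" and full: "sum s A = W"
    and uv: "0 \<le> u" "u \<le> v" "v \<le> W"
    and gap: "\<And>i. i \<in> A \<Longrightarrow> x i + s i \<le> u \<or> v \<le> x i"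
  shows "u = v" "(\<Sum>i\<in>A. if x i + s i \<le> u then s i else 0) = u"
proof -
  define L where "L = {i \<in> A. x i + s i \<le> u}"
  have finA: "finite A" using A(1) finite_I finite_subset by blast
  have "sum s L \<le> u - 0"
    using A x_nonneg uv by (intro row_sum_between[where c = c]) (auto simp: L_def)
  moreover have "sum s (A - L) \<le> W - v"
    using A x_le uv gap by (intro row_sum_between[where c = c]) (auto simp: L_def)
  moreover have "sum s A = sum s L + sum s (A - L)"
    using finA by (subst sum.subset_diff[of L]) (auto simp: L_def)
  ultimately have *: "u = v" "sum s L = u" using full uv by auto
  show "u = v" by fact
  show "(\<Sum>i\<in>A. if x i + s i \<le> u then s i else 0) = u"
    using *(2) finA by (simp add: L_def sum.inter_filter)
qed

end

text \<open>Integrality test for comparing two rows: unit squares contribute integers, so small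
  multiples of \<open>d\<close> left by the large squares must cancel.\<close>

lemma real_nat_eq_int_plus_smallD:
  assumes "real n = of_int k + c" "\<bar>c\<bar> < 1"
  shows "c = 0"
proof -
  have c: "c = of_int (int n - k)" using assms(1) by simp
  with assms(2) have "\<bar>int n - k\<bar> < 1" by linarith
  with c show ?thesis by simp
qed

section \<open>The instance\<close>

locale bl_rows = bl_packing W I s x y \<tau>
  for W :: real and I :: "'a set" and s x y :: "'a \<Rightarrow> real" and \<tau> +
  fixes d :: real and p1 p2 q1 q2 z :: 'a and X Y :: "'a set"
  assumes d: "0 < d" "d \<le> 1/100" and W: "W = 9 - d"
    and I_eq: "I = {p1,p2,q1,q2,z} \<union> X \<union> Y"
    and dist: "distinct [p1,p2,q1,q2,z]" "{p1,p2,q1,q2,z} \<inter> (X \<union> Y) = {}" "X \<inter> Y = {}"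
    and card_X: "card X = 5" and card_Y: "card Y = 5"
    and s_big: "s p1 = 2 - 3*d" "s p2 = 2 + 2*d" "s q1 = 2 - 3*d" "s q2 = 2 + 2*d" "s z = 1 + d"
    and s_unit: "i \<in> X \<union> Y \<Longrightarrow> s i = 1"
    and y_p: "y p1 = 0" "y p2 = 0"
    and y_q: "1 \<le> y q1" "y q1 \<le> 1 + d" "1 \<le> y q2" "y q2 \<le> 1 + d"
    and y_z: "y z = 1"
    and y_X: "i \<in> X \<Longrightarrow> y i = 0"
    and y_Y: "i \<in> Y \<Longrightarrow> 2 - 3*d \<le> y i \<and> y i \<le> 2 + 2*d"
begin

lemma in_I [simp]: "p1 \<in> I" "p2 \<in> I" "q1 \<in> I" "q2 \<in> I" "z \<in> I"
  by (auto simp: I_eq)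

lemma fin_XY [simp]: "finite X" "finite Y"
  using finite_I by (auto simp: I_eq)

definition left where "left u i = (if x i + s i \<le> u then s i else 0)"

lemma left_units:
  assumes "A \<subseteq> X \<union> Y"
  obtains n where "sum (left u) A = real n"
proof -
  have "sum (left u) A = (\<Sum>i\<in>A. if x i + s i \<le> u then 1 else 0)"
    using assms s_unit by (intro sum.cong) (auto simp: left_def)
  also have "\<dots> = real (card {i\<in>A. x i + s i \<le> u})"
    using finite_subset[OF assms] by (simp add: sum.inter_filter[symmetric])
  finally show thesis by (rule that)
qed

lemma row0_cross: "i \<in> {p1,p2} \<union> X \<Longrightarrow> y i < 1/2 \<and> 1/2 < y i + s i"
  using y_p y_X s_big s_unit d by auto

lemma row1_cross: "i \<in> {p1,p2,q1,q2,z} \<Longrightarrow> y i < 3/2 \<and> 3/2 < y i + s i"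
  using y_p y_q y_z s_big d by auto

lemma row2_cross: "i \<in> {q1,q2} \<union> Y \<Longrightarrow> y i < 5/2 \<and> 5/2 < y i + s i"
  using y_q s_big s_unit y_Y d by force

lemma row0_full: "sum s ({p1,p2} \<union> X) = W"
proof -
  have "sum s ({p1,p2} \<union> X) = sum s {p1,p2} + sum s X"
    using dist by (intro sum.union_disjoint) auto
  then show ?thesis using dist s_big s_unit card_X W by simp
qed

lemma row1_full: "sum s {p1,p2,q1,q2,z} = W"
  using dist s_big W by auto

lemma row2_full: "sum s ({q1,q2} \<union> Y) = W"
proof -
  have "sum s ({q1,q2} \<union> Y) = sum s {q1,q2} + sum s Y"
    using dist by (intro sum.union_disjoint) auto
  then show ?thesis using dist s_big s_unit card_Y W by simp
qed

text \<open>A vertical line at \<open>u\<close> that cuts no square of the full bottom row has width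
  exactly \<open>u\<close> to its left. The large squares thus determine \<open>u\<close> up to an
  integer. \<open>wall1\<close> and \<open>wall2\<close> treat the other two rows.\<close>

lemma wall0:
  assumes "0 \<le> u" "u \<le> W" "\<And>i. i \<in> {p1,p2} \<union> X \<Longrightarrow> x i + s i \<le> u \<or> u \<le> x i"
  obtains n where "left u p1 + left u p2 + real n = u"
proof -
  have "(\<Sum>i\<in>{p1,p2} \<union> X. left u i) = u"
    unfolding left_def using assms row0_cross row0_full
    by (intro full_row_gap(2)[where c = "1/2" and v = u]) (auto simp: I_eq)
  moreover have "(\<Sum>i\<in>{p1,p2} \<union> X. left u i) = (\<Sum>i\<in>{p1,p2}. left u i) + sum (left u) X"
    using dist by (intro sum.union_disjoint) auto
  moreover obtain n where "sum (left u) X = real n" using left_units[of X] by blast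
  ultimately show thesis using that[of n] dist by simp
qed

lemma wall1:
  assumes "0 \<le> u" "u \<le> W" "\<And>i. i \<in> {p1,p2,q1,q2,z} \<Longrightarrow> x i + s i \<le> u \<or> u \<le> x i"
  shows "left u p1 + left u p2 + left u q1 + left u q2 + left u z = u"
proof -
  have "(\<Sum>i\<in>{p1,p2,q1,q2,z}. left u i) = u"
    unfolding left_def using assms row1_cross row1_full
    by (intro full_row_gap(2)[where c = "3/2" and v = u]) auto
  then show ?thesis using dist by (auto simp: algebra_simps)
qed

lemma wall2:
  assumes "0 \<le> u" "u \<le> W" "\<And>i. i \<in> {q1,q2} \<union> Y \<Longrightarrow> x i + s i \<le> u \<or> u \<le> x i"
  obtains n where "left u q1 + left u q2 + real n = u"
proof -
  have "(\<Sum>i\<in>{q1,q2} \<union> Y. left u i) = u"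
    unfolding left_def using assms row2_cross row2_full
    by (intro full_row_gap(2)[where c = "5/2" and v = u]) (auto simp: I_eq)
  moreover have "(\<Sum>i\<in>{q1,q2} \<union> Y. left u i) = (\<Sum>i\<in>{q1,q2}. left u i) + sum (left u) Y"
    using dist by (intro sum.union_disjoint) auto
  moreover obtain n where "sum (left u) Y = real n" using left_units[of Y] by blast
  ultimately show thesis using that[of n] dist by simp
qed

lemma no_gap1:
  assumes "0 \<le> u" "u < v" "v \<le> W" "\<And>i. i \<in> {p1,p2,q1,q2,z} \<Longrightarrow> x i + s i \<le> u \<or> v \<le> x i"
  shows False
  using full_row_gap(1)[of "{p1,p2,q1,q2,z}" "3/2" u v] row1_cross row1_full assms by force

lemma apart0:
  assumes "i \<in> {p1,p2} \<union> X" "j \<in> {p1,p2} \<union> X" "i \<noteq> j"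
  shows "x i + s i \<le> x j \<or> x j + s j \<le> x i"
  using row_separated[of i j "1/2"] row0_cross[OF assms(1)] row0_cross[OF assms(2)] assms
  by (auto simp: I_eq)

lemma apart1:
  assumes "i \<in> {p1,p2,q1,q2,z}" "j \<in> {p1,p2,q1,q2,z}" "i \<noteq> j"
  shows "x i + s i \<le> x j \<or> x j + s j \<le> x i"
  using row_separated[of i j "3/2"] row1_cross[OF assms(1)] row1_cross[OF assms(2)] assms
  by (auto simp: I_eq)

lemma apart2:
  assumes "i \<in> {q1,q2} \<union> Y" "j \<in> {q1,q2} \<union> Y" "i \<noteq> j"
  shows "x i + s i \<le> x j \<or> x j + s j \<le> x i"
  using row_separated[of i j "5/2"] row2_cross[OF assms(1)] row2_cross[OF assms(2)] assms
  by (auto simp: I_eq)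

text \<open>The left edge of a square cuts no square of its own row, hence is such a vertical
  line.\<close>

lemma wall_at0:
  assumes "i \<in> {p1,p2} \<union> X"
  obtains n where "left (x i) p1 + left (x i) p2 + real n = x i"
proof (rule wall0[of "x i"])
  have i: "i \<in> I" using assms by (auto simp: I_eq)
  show "0 \<le> x i" "x i \<le> W" using x_nonneg[OF i] x_le[OF i] size_pos[OF i] by auto
  show "x j + s j \<le> x i \<or> x i \<le> x j" if "j \<in> {p1,p2} \<union> X" for j
    using apart0[OF assms that] size_pos[OF i] by fastforce
qed (rule that)

lemma wall_at1:
  assumes "i \<in> {p1,p2,q1,q2,z}"
  shows "left (x i) p1 + left (x i) p2 + left (x i) q1 + left (x i) q2 + left (x i) z = x i"
proof (rule wall1)
  have i: "i \<in> I" using assms by (auto simp: I_eq)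
  show "0 \<le> x i" "x i \<le> W" using x_nonneg[OF i] x_le[OF i] size_pos[OF i] by auto
  show "x j + s j \<le> x i \<or> x i \<le> x j" if "j \<in> {p1,p2,q1,q2,z}" for j
    using apart1[OF assms that] size_pos[OF i] by fastforce
qed

lemma wall_at2:
  assumes "i \<in> {q1,q2} \<union> Y"
  obtains n where "left (x i) q1 + left (x i) q2 + real n = x i"
proof (rule wall2[of "x i"])
  have i: "i \<in> I" using assms by (auto simp: I_eq)
  show "0 \<le> x i" "x i \<le> W" using x_nonneg[OF i] x_le[OF i] size_pos[OF i] by auto
  show "x j + s j \<le> x i \<or> x i \<le> x j" if "j \<in> {q1,q2} \<union> Y" for j
    using apart2[OF assms that] size_pos[OF i] by fastforce
qed (rule that)

lemma contradiction: False
proof -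
  have pw: "x i + s i \<le> x j \<or> x j + s j \<le> x i"
    if "i \<in> {p1,p2,q1,q2,z}" "j \<in> {p1,p2,q1,q2,z}" "i \<noteq> j" for i j
    by (rule apart1[OF that])
  have "Y \<noteq> {}" using card_Y by auto
  then obtain a where a: "a \<in> Y" and amin: "\<And>j. j \<in> Y \<Longrightarrow> \<tau> a \<le> \<tau> j"
    using ex_has_least_nat[of "\<lambda>j. j \<in> Y" _ \<tau>] by blast
  have "card (Y - {a}) = 4" using a card_Y by simp
  then have "Y - {a} \<noteq> {}" by (metis card.empty zero_neq_numeral)
  then obtain b where b': "b \<in> Y - {a}" and bmin: "\<And>j. j \<in> Y - {a} \<Longrightarrow> \<tau> b \<le> \<tau> j"
    using ex_has_least_nat[of "\<lambda>j. j \<in> Y - {a}" _ \<tau>] by blast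
  then have b: "b \<in> Y" "b \<noteq> a" by auto
  have sa: "s a = 1" and sb: "s b = 1" using a b s_unit by auto
  have aI: "a \<in> I" and bI: "b \<in> I" using a b by (auto simp: I_eq)
  have ne: "a \<notin> {p1,p2,q1,q2,z}" "b \<notin> {p1,p2,q1,q2,z}" using a b dist by auto
  \<comment> \<open>The left end of the top of \<open>p1\<close> is free when \<open>a\<close> is
    placed: \<open>a\<close> is the first of \<open>Y\<close>, the units of \<open>X\<close> are too
    low, and the other large squares and \<open>z\<close> lie beside \<open>p1\<close>.\<close>
  have ya: "y a = 2 - 3*d \<and> x a \<le> x p1"
  proof -
    have "y a < 2 - 3*d \<or> y a = 2 - 3*d \<and> x a \<le> x p1"
    proof (rule bottom_left[OF aI])
      show "0 \<le> x p1" "x p1 + s a \<le> W"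
        using x_nonneg[of p1] x_le[of p1] s_big sa d by auto
      show "0 \<le> 2 - 3*d" using d by auto
      fix j assume j: "j \<in> I" "\<tau> j < \<tau> a"
      then consider "j \<in> X" | "j = p1" | "j \<in> {p1,p2,q1,q2,z}" "j \<noteq> p1"
        using amin[of j] by (auto simp: I_eq)
      then show "x j + s j \<le> x p1 \<or> x p1 + s a \<le> x j \<or> y j + s j \<le> 2 - 3*d \<or> 2 - 3*d + s a \<le> y j"
      proof cases
        case 1
        then show ?thesis using y_X[of j] s_unit[of j] d by auto
      next
        case 2
        then show ?thesis using y_p s_big by auto
      next
        case 3
        then show ?thesis using pw[of j p1] s_big sa d by auto
      qed
    qed
    then show ?thesis using y_Y[OF a] by auto
  qed
  have a_apart: "x a + 1 \<le> x i \<or> x i + s i \<le> x a" if "i \<in> {p2,q1,q2,z}" for i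
    using separated[OF aI, of i] that ne ya sa s_big y_p y_q y_z d by auto
  \<comment> \<open>In the middle row only \<open>p1\<close> can lie below or above
    \<open>a\<close>, so a part of \<open>a\<close> overhanging \<open>p1\<close> on the left would
    give a gap in that full row.\<close>
  have xa: "x a = x p1"
  proof (rule ccontr)
    assume "x a \<noteq> x p1"
    then have less: "x a < x p1" using ya by auto
    show False
    proof (rule no_gap1[of "x a" "min (x a + 1) (x p1)"])
      show "0 \<le> x a" using x_nonneg[OF aI] .
      show "x a < min (x a + 1) (x p1)" using less by auto
      show "min (x a + 1) (x p1) \<le> W" using x_le[OF aI] sa by auto
      show "x i + s i \<le> x a \<or> min (x a + 1) (x p1) \<le> x i" if "i \<in> {p1,p2,q1,q2,z}" for i
        using a_apart[of i] that by auto
    qed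
  qed
  \<comment> \<open>All three rows have a wall at \<open>x p1\<close>, the top row because of
    \<open>a\<close>. Middle against top excludes \<open>p2\<close> and \<open>z\<close> from the
    left side, bottom against middle then excludes \<open>q1\<close> and \<open>q2\<close>; so
    \<open>p1\<close> stands at the left border.\<close>
  obtain n0 where n0: "left (x p1) p1 + left (x p1) p2 + real n0 = x p1"
    using wall_at0[of p1] by auto
  have n1: "left (x p1) p1 + left (x p1) p2 + left (x p1) q1 + left (x p1) q2 + left (x p1) z = x p1"
    using wall_at1[of p1] by auto
  obtain n2 where n2: "left (x p1) q1 + left (x p1) q2 + real n2 = x p1"
    using wall_at2[of a] a xa by auto
  have lp1: "left (x p1) p1 = 0" using size_pos[of p1] by (auto simp: left_def)
  have e: "real n2 = left (x p1) p2 + left (x p1) z" using n1 n2 lp1 by auto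
  have lp2: "left (x p1) p2 = 0"
    using e real_nat_eq_int_plus_smallD[of n2 2 "2*d"] real_nat_eq_int_plus_smallD[of n2 3 "3*d"]
      s_big d by (auto simp: left_def split: if_splits)
  have lz: "left (x p1) z = 0"
    using e lp2 real_nat_eq_int_plus_smallD[of n2 1 "d"] s_big d
    by (auto simp: left_def split: if_splits)
  have e': "real n0 = left (x p1) q1 + left (x p1) q2" using n0 n1 lp1 lp2 lz by auto
  have x_p1: "x p1 = 0"
    using e' n0 lp1 lp2 real_nat_eq_int_plus_smallD[of n0 2 "-3*d"]
      real_nat_eq_int_plus_smallD[of n0 2 "2*d"] real_nat_eq_int_plus_smallD[of n0 4 "-d"]
      s_big d by (auto simp: left_def split: if_splits)
  have x_ge: "2 - 3*d \<le> x i" if "i \<in> {p2,q1,q2,z}" for i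
    using pw[of i p1] that dist x_p1 s_big x_nonneg[of i] size_pos[of i] by auto
  \<comment> \<open>As for \<open>a\<close>, the left end of the top of \<open>z\<close> is free
    when \<open>b\<close> is placed, since \<open>a\<close> ends before \<open>z\<close>
    starts.\<close>
  have yb: "y b < 2 + d \<or> y b = 2 + d \<and> x b \<le> x z"
  proof (rule bottom_left[OF bI])
    show "0 \<le> x z" "x z + s b \<le> W"
      using x_nonneg[of z] x_le[of z] s_big sb d by auto
    show "0 \<le> 2 + d" using d by auto
    fix j assume j: "j \<in> I" "\<tau> j < \<tau> b"
    then consider "j \<in> X" | "j = z" | "j = a" | "j \<in> {p1,p2,q1,q2,z}" "j \<noteq> z"
      using bmin[of j] by (auto simp: I_eq)
    then show "x j + s j \<le> x z \<or> x z + s b \<le> x j \<or> y j + s j \<le> 2 + d \<or> 2 + d + s b \<le> y j"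
    proof cases
      case 1
      then show ?thesis using y_X[of j] s_unit[of j] d by auto
    next
      case 2
      then show ?thesis using y_z s_big by auto
    next
      case 3
      then show ?thesis using a_apart[of z] sa s_big x_nonneg[OF aI] d x_p1 xa x_ge[of z] by auto
    next
      case 4
      then show ?thesis using pw[of j z] s_big sb d by auto
    qed
  qed
  have b_apart: "x b + 1 \<le> x i \<or> x i + s i \<le> x b" if "i \<in> {p2,q1,q2}" for i
    using separated[OF bI, of i] that ne yb y_Y[OF b(1)] sb s_big y_p y_q d by auto
  have xb: "1 \<le> x b"
    using apart2[of a b] a b sa sb xa x_p1 x_nonneg[OF bI] by auto
  \<comment> \<open>Because \<open>a\<close> occupies the first unit, \<open>b\<close> ends at 2 or
    later, beyond the right end \<open>2 - 3*d\<close> of \<open>p1\<close>. If \<open>b\<close>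
    also avoided \<open>z\<close>, its part beyond \<open>p1\<close> would mark a gap in the middle
    row.\<close>
  have nz: "\<not> (x b + 1 \<le> x z \<or> x z + s z \<le> x b)"
  proof
    assume z_apart: "x b + 1 \<le> x z \<or> x z + s z \<le> x b"
    show False
    proof (rule no_gap1[of "max (x b) (2 - 3*d)" "x b + 1"])
      show "x b + 1 \<le> W" using x_le[OF bI] sb by auto
      show "x i + s i \<le> max (x b) (2 - 3*d) \<or> x b + 1 \<le> x i" if "i \<in> {p1,p2,q1,q2,z}" for i
        using b_apart[of i] z_apart that x_p1 s_big by auto
    qed (use xb d in auto)
  qed
  then have "y b = 2 + d" and xbz: "x b \<le> x z"
    using separated[OF bI, of z] ne yb y_Y[OF b(1)] sb s_big y_z d by auto
  \<comment> \<open>Again a gap argument: the part of \<open>b\<close> between \<open>p1\<close> and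
    \<open>z\<close> must be empty, so \<open>b\<close> is aligned with \<open>z\<close> or
    \<open>z\<close> touches \<open>p1\<close>.\<close>
  have "x b = x z \<or> x z = 2 - 3*d"
  proof (rule ccontr)
    assume "\<not> ?thesis"
    then have less: "x b < x z" "2 - 3*d < x z" using xbz x_ge[of z] by auto
    show False
    proof (rule no_gap1[of "max (x b) (2 - 3*d)" "x z"])
      show "x z \<le> W" using x_le[of z] s_big d by auto
      show "x i + s i \<le> max (x b) (2 - 3*d) \<or> x z \<le> x i" if "i \<in> {p1,p2,q1,q2,z}" for i
        using b_apart[of i] nz that x_p1 s_big by auto
    qed (use xb less in auto)
  qed
  then show False
  proof
    \<comment> \<open>The middle and top rows share the wall at \<open>x z\<close>;
      \<open>p1\<close>, with or without \<open>p2\<close>, would have to have integral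
      width.\<close>
    assume eq: "x b = x z"
    have m1: "left (x z) p1 + left (x z) p2 + left (x z) q1 + left (x z) q2 + left (x z) z = x z"
      using wall_at1[of z] by auto
    obtain m2 where m2: "left (x z) q1 + left (x z) q2 + real m2 = x z"
      using wall_at2[of b] b eq by auto
    have "left (x z) p1 = 2 - 3*d" using x_ge[of z] x_p1 s_big by (auto simp: left_def)
    moreover have "left (x z) z = 0" using size_pos[of z] by (auto simp: left_def)
    ultimately have "real m2 = 2 - 3*d + left (x z) p2" using m1 m2 by auto
    then show False
      using real_nat_eq_int_plus_smallD[of m2 2 "-3*d"] real_nat_eq_int_plus_smallD[of m2 4 "-d"]
        s_big d by (auto simp: left_def split: if_splits)
  next
    \<comment> \<open>The middle row starts with \<open>p1\<close>, \<open>z\<close>. The wall at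
      \<open>x p2\<close> in the two lower rows puts \<open>q1\<close> before \<open>p2\<close>;
      then the wall at \<open>x q1\<close> in the two upper rows needs \<open>p1\<close> and
      \<open>z\<close> to have integral width, but it is \<open>3 - 2*d\<close>.\<close>
    assume xz: "x z = 2 - 3*d"
    have after: "3 - 2*d \<le> x i" if "i \<in> {p2,q1,q2}" for i
      using pw[of i z] x_ge[of i] that dist xz s_big size_pos[of i] by auto
    have m1: "left (x p2) p1 + left (x p2) p2 + left (x p2) q1 + left (x p2) q2 + left (x p2) z = x p2"
      using wall_at1[of p2] by auto
    obtain m0 where m0: "left (x p2) p1 + left (x p2) p2 + real m0 = x p2"
      using wall_at0[of p2] by auto
    have "left (x p2) z = 1 + d" using after[of p2] xz s_big by (auto simp: left_def)
    then have e0: "real m0 = 1 + d + left (x p2) q1 + left (x p2) q2" using m0 m1 by auto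
    have "left (x p2) q1 \<noteq> 0"
      using e0 real_nat_eq_int_plus_smallD[of m0 1 "d"] real_nat_eq_int_plus_smallD[of m0 3 "3*d"]
        s_big d by (auto simp: left_def split: if_splits)
    then have "x q1 + s q1 \<le> x p2" by (auto simp: left_def split: if_splits)
    then have "left (x q1) p2 = 0" using size_pos[of p2] size_pos[of q1] by (auto simp: left_def)
    moreover have "left (x q1) p1 = 2 - 3*d" "left (x q1) z = 1 + d"
      using after[of q1] x_p1 xz s_big d by (auto simp: left_def)
    moreover have
      "left (x q1) p1 + left (x q1) p2 + left (x q1) q1 + left (x q1) q2 + left (x q1) z = x q1"
      using wall_at1[of q1] by auto
    moreover obtain k where "left (x q1) q1 + left (x q1) q2 + real k = x q1"
      using wall_at2[of q1] by auto
    ultimately have "real k = 3 - 2*d" by auto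
    then show False using real_nat_eq_int_plus_smallD[of k 3 "-2*d"] d by auto
  qed
qed

end


section \<open>Low packings consist of three full rows\<close>

context bl_packing
begin

lemma tall_packing:
  assumes d: "0 < d" "d \<le> 1/100" and W: "W = 9 - d"
    and I_eq: "I = {a1,a2,b1,b2,z} \<union> U"
    and dist: "distinct [a1,a2,b1,b2,z]" "{a1,a2,b1,b2,z} \<inter> U = {}"
    and card_U: "card U = 10"
    and s_big: "s a1 = 2 - 3*d" "s a2 = 2 - 3*d" "s b1 = 2 + 2*d" "s b2 = 2 + 2*d" "s z = 1 + d"
    and s_unit: "\<And>i. i \<in> U \<Longrightarrow> s i = 1"
  shows "\<exists>i\<in>I. 4 - 6*d \<le> y i + s i"
proof (rule ccontr)
  assume "\<not> ?thesis"
  then have low: "y i + s i < 4 - 6*d" if "i \<in> I" for i using that by force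
  have sizes: "s i = 1 \<or> s i = 1 + d \<or> s i = 2 - 3*d \<or> s i = 2 + 2*d" if "i \<in> I" for i
    using that I_eq s_big s_unit by auto
  \<comment> \<open>By induction along supports, every height is a sum of side lengths, each close
    to 1 or 2.\<close>
  have levels: "y i = 0 \<or> 1 \<le> y i \<and> y i \<le> 1 + d \<or> 2 - 3*d \<le> y i \<and> y i \<le> 2 + 2*d \<or> 3 - 3*d \<le> y i"
    if "i \<in> I" for i
    using that
  proof (induction "\<tau> i" arbitrary: i rule: less_induct)
    case less
    show ?case
    proof (cases "y i = 0")
      case False
      then obtain j where j: "j \<in> I" "\<tau> j < \<tau> i" "y i = y j + s j"
        using supported[OF less.prems] by blast
      show ?thesis using less.hyps[OF j(2,1)] sizes[OF j(1)] j(3) d by auto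
    qed simp
  qed
  define T where "T = {a1,a2,b1,b2}"
  define row where "row A k = {i \<in> A. k - 1/2 < y i \<and> y i < k + 1/2}" for A and k :: real
  have finU: "finite U" using card_U card.infinite by fastforce
  have TI: "T \<subseteq> I" and UI: "insert z U \<subseteq> I" using I_eq by (auto simp: T_def)
  have sT: "s i = 2 - 3*d \<or> s i = 2 + 2*d" if "i \<in> T" for i using that s_big by (auto simp: T_def)
  have sU: "s i = 1 \<or> s i = 1 + d" if "i \<in> insert z U" for i using that s_big s_unit by auto
  \<comment> \<open>A large square starting at \<open>2 - 3*d\<close> or higher would reach
    \<open>4 - 6*d\<close>; the bound of the lemma comes from here.\<close>
  have lev_T: "y i = 0 \<or> 1 \<le> y i \<and> y i \<le> 1 + d" if "i \<in> T" for i
    using levels[of i] low[of i] sT[OF that] TI that d by auto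
  have lev_U: "y i = 0 \<or> 1 \<le> y i \<and> y i \<le> 1 + d \<or> 2 - 3*d \<le> y i \<and> y i \<le> 2 + 2*d"
    if "i \<in> insert z U" for i
    using levels[of i] low[of i] sU[OF that] UI that d by auto
  have disjTU: "T \<inter> insert z U = {}" using dist by (auto simp: T_def)
  have finT: "finite T" by (simp add: T_def)
  have sumT: "sum s T = 8 - 2*d" using dist s_big by (simp add: T_def)
  have sumU: "sum s (insert z U) = 11 + d" using dist s_big s_unit card_U finU by simp
  have W0: "0 \<le> W" using W d by simp
  have T_split: "sum s T = sum s (row T 0) + sum s (row T 1)"
  proof -
    have "T = row T 0 \<union> row T 1"
      using lev_T d by (force simp: row_def)
    then have "sum s T = sum s (row T 0 \<union> row T 1)" by simp
    also have "\<dots> = sum s (row T 0) + sum s (row T 1)"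
      using finT by (intro sum.union_disjoint) (auto simp: row_def)
    finally show ?thesis .
  qed
  have U_split: "sum s (insert z U) = sum s (row (insert z U) 0) + sum s (row (insert z U) 1) + sum s (row (insert z U) 2)"
  proof -
    have "insert z U = (row (insert z U) 0 \<union> row (insert z U) 1) \<union> row (insert z U) 2"
      using lev_U d by (force simp: row_def)
    then have "sum s (insert z U) = sum s ((row (insert z U) 0 \<union> row (insert z U) 1) \<union> row (insert z U) 2)"
      by simp
    also have "\<dots> = sum s (row (insert z U) 0) + sum s (row (insert z U) 1) + sum s (row (insert z U) 2)"
      using finU by (subst sum.union_disjoint sum.union_disjoint; auto simp: row_def)+
    finally show ?thesis .
  qed
  have r0: "sum s (row T 0) + sum s (row (insert z U) 0) \<le> W"
  proof -
    have "y i < 1/2 \<and> 1/2 < y i + s i" if "i \<in> row T 0 \<union> row (insert z U) 0" for i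
      using that sT[of i] sU[of i] lev_T[of i] lev_U[of i] d by (auto simp: row_def)
    moreover have "row T 0 \<union> row (insert z U) 0 \<subseteq> I" using TI UI by (auto simp: row_def)
    ultimately have "sum s (row T 0 \<union> row (insert z U) 0) \<le> W" using W0 by (intro row_sum_le)
    then show ?thesis using finT finU disjTU
      by (subst (asm) sum.union_disjoint) (auto simp: row_def)
  qed
  \<comment> \<open>All of \<open>T\<close> counts here: a large square crosses height 3/2 whether
    it starts at the floor or near height 1.\<close>
  have r1: "sum s T + sum s (row (insert z U) 1) \<le> W"
  proof -
    have "y i < 3/2 \<and> 3/2 < y i + s i" if "i \<in> T \<union> row (insert z U) 1" for i
      using that sT[of i] sU[of i] lev_T[of i] lev_U[of i] d by (auto simp: row_def)
    moreover have "T \<union> row (insert z U) 1 \<subseteq> I" using TI UI by (auto simp: row_def)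
    ultimately have "sum s (T \<union> row (insert z U) 1) \<le> W" using W0 by (intro row_sum_le)
    then show ?thesis using finT finU disjTU
      by (subst (asm) sum.union_disjoint) (auto simp: row_def)
  qed
  have r2: "sum s (row T 1) + sum s (row (insert z U) 2) \<le> W"
  proof -
    have "y i < 5/2 \<and> 5/2 < y i + s i" if "i \<in> row T 1 \<union> row (insert z U) 2" for i
      using that sT[of i] sU[of i] lev_T[of i] lev_U[of i] d by (auto simp: row_def)
    moreover have "row T 1 \<union> row (insert z U) 2 \<subseteq> I" using TI UI by (auto simp: row_def)
    ultimately have "sum s (row T 1 \<union> row (insert z U) 2) \<le> W" using W0 by (intro row_sum_le)
    then show ?thesis using finT finU disjTU
      by (subst (asm) sum.union_disjoint) (auto simp: row_def)
  qed
  \<comment> \<open>The left sides of \<open>r0\<close>, \<open>r1\<close>, \<open>r2\<close> add up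
    to \<open>2 * (8 - 2*d) + (11 + d)\<close>, which is \<open>3 * W\<close>, so all three are
    equalities.\<close>
  have e1: "sum s (row (insert z U) 1) = 1 + d"
    and e0: "sum s (row T 0) + sum s (row (insert z U) 0) = 9 - d"
    using r0 r1 r2 T_split U_split sumT sumU W by auto
  have sum_units: "sum s A = real (card A)" if "A \<subseteq> U" for A
    using that s_unit by (subst sum.cong[of A A s "\<lambda>_. 1"]) auto
  have fin_row: "finite (row A k)" if "finite A" for A k using that by (simp add: row_def)
  \<comment> \<open>Units alone cannot have total width \<open>1 + d\<close>.\<close>
  have z1: "z \<in> row (insert z U) 1"
  proof (rule ccontr)
    assume "z \<notin> row (insert z U) 1"
    then have "row (insert z U) 1 \<subseteq> U" by (auto simp: row_def)
    then have "real (card (row (insert z U) 1)) = 1 + d" using e1 sum_units by metis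
    then show False using real_nat_eq_int_plus_smallD[of _ 1 d] d by auto
  qed
  have row_z: "row (insert z U) 1 = insert z (row U 1)" "row (insert z U) 0 = row U 0"
    "row (insert z U) 2 = row U 2"
    using z1 by (auto simp: row_def)
  have rowU1: "row U 1 = {}"
  proof -
    have sub: "row U 1 \<subseteq> U" by (auto simp: row_def)
    then have fin: "finite (row U 1)" and "z \<notin> row U 1" using finU dist finite_subset by auto
    then have "sum s (row U 1) = 0" using e1 row_z(1) s_big by simp
    then show ?thesis using sum_units[OF sub] fin by simp
  qed
  have card_rows: "card (row U 0) + card (row U 2) = 10"
  proof -
    have "U = row U 0 \<union> row U 2" using lev_U d rowU1 by (force simp: row_def)
    then have "card U = card (row U 0 \<union> row U 2)" by simp
    also have "\<dots> = card (row U 0) + card (row U 2)"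
      using finU by (intro card_Un_disjoint) (auto simp: row_def)
    finally show ?thesis using card_U by simp
  qed
  \<comment> \<open>The support of \<open>z\<close> starts at the floor and has height at most
    \<open>1 + d\<close>; it is not \<open>z\<close> itself, so it is a unit.\<close>
  have yz: "y z = 1"
  proof -
    have yz: "1 \<le> y z" "y z \<le> 1 + d" using lev_U[of z] z1 d by (auto simp: row_def)
    then obtain j where j: "j \<in> I" "\<tau> j < \<tau> z" "y z = y j + s j"
      using supported[of z] UI by (metis insert_subset not_one_le_zero)
    then have yj: "y j = 0" using levels[OF j(1)] sizes[OF j(1)] yz d by auto
    have "j \<in> U" using j yj yz s_big d I_eq by auto
    then show ?thesis using j yj s_unit by simp
  qed
  \<comment> \<open>Which square of each equal pair is on the floor is left open, so that one proof
    serves all four labellings.\<close>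
  have core: False if p: "(p1 = a1 \<and> q1 = a2) \<or> (p1 = a2 \<and> q1 = a1)"
      "(p2 = b1 \<and> q2 = b2) \<or> (p2 = b2 \<and> q2 = b1)"
      and y0: "y p1 = 0" "y p2 = 0" "y q1 \<noteq> 0" "y q2 \<noteq> 0" and card0: "card (row U 0) = 5" for p1 p2 q1 q2
  proof -
    have "p1 \<in> T" "p2 \<in> T" "q1 \<in> T" "q2 \<in> T" using p by (auto simp: T_def)
    interpret bl_rows W I s x y \<tau> d p1 p2 q1 q2 z "row U 0" "row U 2"
    proof
      show "0 < d" "d \<le> 1/100" "W = 9 - d" "y z = 1" "y p1 = 0" "y p2 = 0" by fact+
      show "1 \<le> y q1" "y q1 \<le> 1 + d" "1 \<le> y q2" "y q2 \<le> 1 + d"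
        using lev_T[of q1] lev_T[of q2] y0 \<open>q1 \<in> T\<close> \<open>q2 \<in> T\<close> by auto
      have "U = row U 0 \<union> row U 2" using lev_U d rowU1 by (force simp: row_def)
      then show "I = {p1,p2,q1,q2,z} \<union> row U 0 \<union> row U 2" using I_eq p by auto
      show "distinct [p1,p2,q1,q2,z]" "{p1,p2,q1,q2,z} \<inter> (row U 0 \<union> row U 2) = {}"
        using dist p by (auto simp: row_def)
      show "row U 0 \<inter> row U 2 = {}" by (auto simp: row_def)
      show "card (row U 0) = 5" "card (row U 2) = 5" using card0 card_rows by auto
      show "s p1 = 2 - 3*d" "s p2 = 2 + 2*d" "s q1 = 2 - 3*d" "s q2 = 2 + 2*d" "s z = 1 + d"
        using p s_big by auto
      show "s i = 1" if "i \<in> row U 0 \<union> row U 2" for i using that s_unit by (auto simp: row_def)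
      show "y i = 0" if "i \<in> row U 0" for i using that lev_U[of i] d by (auto simp: row_def)
      show "2 - 3*d \<le> y i \<and> y i \<le> 2 + 2*d" if "i \<in> row U 2" for i
        using that lev_U[of i] d by (auto simp: row_def)
    qed
    show False by (rule contradiction)
  qed
  define n where "n = card (row U 0)"
  have "sum s (row T 0) = (\<Sum>i\<in>T. if y i = 0 then s i else 0)"
    unfolding sum.inter_filter[symmetric, OF finT] row_def using lev_T d by (intro sum.cong) force+
  also have "\<dots> = (if y a1 = 0 then 2 - 3*d else 0) + (if y a2 = 0 then 2 - 3*d else 0)
      + (if y b1 = 0 then 2 + 2*d else 0) + (if y b2 = 0 then 2 + 2*d else 0)" (is "_ = ?B")
    using dist s_big by (simp add: T_def)
  finally have eq: "?B + real n = 9 - d"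
    using e0 row_z(2) sum_units[of "row U 0"] by (simp add: row_def n_def)
  \<comment> \<open>The coefficient 5 occurs when both squares of side \<open>2 - 3*d\<close>, and
    no other large ones, are on the floor.\<close>
  have not_int: False if "real n = of_int k + c * d" "c \<noteq> 0" "\<bar>c\<bar> \<le> 5" for k c
  proof -
    have "\<bar>c * d\<bar> \<le> 5 * (1/100)" unfolding abs_mult using that d by (intro mult_mono) auto
    then show False using real_nat_eq_int_plus_smallD[OF that(1)] that d by auto
  qed
  \<comment> \<open>Among the choices of large squares on the floor, only one of each size leaves an
    integral width for the units.\<close>
  consider "?B = 0" | "?B = 2 - 3*d" | "?B = 2 + 2*d" | "?B = 4 - 6*d" | "?B = 4 + 4*d"
    | "?B = 6 - 4*d" | "?B = 6 + d" | "?B = 8 - 2*d"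
    | "?B = 4 - d" "y a1 = 0 \<longleftrightarrow> y a2 \<noteq> 0" "y b1 = 0 \<longleftrightarrow> y b2 \<noteq> 0"
    by (cases "y a1 = 0"; cases "y a2 = 0"; cases "y b1 = 0"; cases "y b2 = 0") simp_all
  then have "n = 5 \<and> (y a1 = 0 \<longleftrightarrow> y a2 \<noteq> 0) \<and> (y b1 = 0 \<longleftrightarrow> y b2 \<noteq> 0)"
  proof cases
    case 1 then show ?thesis using eq not_int[of 9 "-1"] by auto
  next
    case 2 then show ?thesis using eq not_int[of 7 2] by auto
  next
    case 3 then show ?thesis using eq not_int[of 7 "-3"] by auto
  next
    case 4 then show ?thesis using eq not_int[of 5 5] by auto
  next
    case 5 then show ?thesis using eq not_int[of 5 "-5"] by auto
  next
    case 6 then show ?thesis using eq not_int[of 3 3] by auto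
  next
    case 7 then show ?thesis using eq not_int[of 3 "-2"] by auto
  next
    case 8 then show ?thesis using eq not_int[of 1 1] by auto
  next
    case 9
    have "real n = 5" using eq 9(1) by linarith
    then show ?thesis using 9 by simp
  qed
  then show False
    using core[of a1 a2 b1 b2] core[of a1 a2 b2 b1] core[of a2 a1 b1 b2] core[of a2 a1 b2 b1]
    by (auto simp: n_def)
qed

end


section \<open>The bottom-left algorithm\<close>

lemma open_rects_disjoint_iff:
  assumes "0 < fst r" "0 < snd r" "0 < fst s" "0 < snd s"
  shows "open_rect p r \<inter> open_rect q s = {} \<longleftrightarrow>
    fst p + fst r \<le> fst q \<or> fst q + fst s \<le> fst p \<or> snd p + snd r \<le> snd q \<or> snd q + snd s \<le> snd p"
    (is "?L \<longleftrightarrow> ?R")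
proof
  assume L: ?L
  show ?R
  proof (rule ccontr)
    assume "\<not> ?R"
    \<comment> \<open>The witness is the centre of the overlap of the two rectangles.\<close>
    then have "((max (fst p) (fst q) + min (fst p + fst r) (fst q + fst s)) / 2,
        (max (snd p) (snd q) + min (snd p + snd r) (snd q + snd s)) / 2)
      \<in> open_rect p r \<inter> open_rect q s"
      using assms by (auto simp: open_rect_def max_def min_def)
    with L show False by blast
  qed
qed (auto simp: open_rect_def)

text \<open>Points higher than some \<open>p0\<close> in \<open>S\<close> cannot compete, so
  \<open>S\<close> may be cut down to a compact set; there the second coordinate is minimised first,
  then the first one.\<close>

lemma ex_yx_lex_min:
  assumes "closed S" "S \<noteq> {}" "\<And>p. p \<in> S \<Longrightarrow> 0 \<le> fst p \<and> fst p \<le> b \<and> 0 \<le> snd p"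
  shows "\<exists>p\<in>S. \<forall>q\<in>S. yx_lex_le p q"
proof -
  obtain p0 where p0: "p0 \<in> S" using assms(2) by blast
  define K where "K = S \<inter> ({0..b} \<times> {0..snd p0})"
  have K: "compact K" "p0 \<in> K"
    using p0 assms by (auto simp: K_def mem_Times_iff intro!: closed_Int_compact compact_Times)
  then obtain p1 where p1: "p1 \<in> K" "\<And>q. q \<in> K \<Longrightarrow> snd p1 \<le> snd q"
    using continuous_attains_inf[of K snd] continuous_on_snd[OF continuous_on_id] by blast
  define K' where "K' = K \<inter> snd -` {snd p1}"
  have "closed (snd -` {snd p1} :: (real \<times> real) set)"
    by (intro closed_vimage continuous_intros)
  then have "compact K'" "p1 \<in> K'"
    using K p1 by (auto simp: K'_def intro: compact_Int_closed)
  then obtain p2 where p2: "p2 \<in> K'" "\<And>q. q \<in> K' \<Longrightarrow> fst p2 \<le> fst q"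
    using continuous_attains_inf[of K' fst] continuous_on_fst[OF continuous_on_id] by blast
  show ?thesis
  proof
    show "p2 \<in> S" using p2 by (simp add: K'_def K_def)
    show "\<forall>q\<in>S. yx_lex_le p2 q"
    proof
      fix q assume q: "q \<in> S"
      have eq: "snd p2 = snd p1" and le: "snd p1 \<le> snd p0" using p2(1) p1(1) by (auto simp: K'_def K_def)
      show "yx_lex_le p2 q"
      proof (cases "snd q \<le> snd p0")
        case True
        then have "q \<in> K" using q assms(3)[OF q] by (auto simp: K_def mem_Times_iff)
        then show ?thesis using p1(2)[of q] p2(2)[of q] eq by (auto simp: yx_lex_le_def K'_def)
      next
        case False
        then show ?thesis using eq le by (simp add: yx_lex_le_def)
      qed
    qed
  qed
qed

text \<open>Justifies the \<open>THE\<close> in \<open>bl_next\<close>: the valid positions form a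
  closed set, nonempty since there is room above all placed rectangles, and \<open>yx_lex_le\<close>
  is antisymmetric.\<close>

lemma bl_next_minimal:
  assumes r: "0 < fst r" "0 < snd r" "fst r \<le> W"
    and placed: "\<And>q s. (q, s) \<in> set placed \<Longrightarrow> 0 < fst s \<and> 0 < snd s"
  shows "valid_next W placed r (bl_next W placed r) \<and>
    (\<forall>q. valid_next W placed r q \<longrightarrow> yx_lex_le (bl_next W placed r) q)"
proof (cases "placed = []")
  case True
  then show ?thesis using r by (auto simp: bl_next_def valid_next_def in_strip_def yx_lex_le_def)
next
  case False
  define S where "S = {p. valid_next W placed r p}"
  have S_eq: "S = {p. 0 \<le> fst p \<and> fst p + fst r \<le> W \<and> 0 \<le> snd p} \<inter>
    (\<Inter>(q, s)\<in>set placed. {p. fst q + fst s \<le> fst p \<or> fst p + fst r \<le> fst q \<or>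
        snd q + snd s \<le> snd p \<or> snd p + snd r \<le> snd q})"
  proof -
    have "open_rect q s \<inter> open_rect p r = {} \<longleftrightarrow> fst q + fst s \<le> fst p \<or> fst p + fst r \<le> fst q \<or>
        snd q + snd s \<le> snd p \<or> snd p + snd r \<le> snd q" if "(q, s) \<in> set placed" for p q s
      using placed[OF that] r by (intro open_rects_disjoint_iff) auto
    then show ?thesis
      unfolding S_def valid_next_def in_strip_def by blast
  qed
  have "closed S"
    unfolding S_eq
    by (intro closed_Int closed_INT ballI)
      (auto split: prod.splits intro!: closed_Collect_conj closed_Collect_disj closed_Collect_le continuous_intros)
  moreover have "S \<noteq> {}"
  proof -
    define H where "H = Max (insert 0 ((\<lambda>(q, s). snd q + snd s) ` set placed))"
    have "0 \<le> H" "\<And>q s. (q, s) \<in> set placed \<Longrightarrow> snd q + snd s \<le> H"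
      by (auto simp: H_def intro!: Max_ge rev_image_eqI)
    then have "(0, H) \<in> S" using r by (auto simp: S_eq)
    then show ?thesis by blast
  qed
  moreover have "0 \<le> fst p \<and> fst p \<le> W \<and> 0 \<le> snd p" if "p \<in> S" for p
    using that r by (auto simp: S_eq)
  ultimately obtain p where p: "p \<in> S" "\<forall>q\<in>S. yx_lex_le p q"
    using ex_yx_lex_min[of S W] by blast
  have "(THE p. valid_next W placed r p \<and> (\<forall>q. valid_next W placed r q \<longrightarrow> yx_lex_le p q)) = p"
  proof (rule the_equality)
    show "valid_next W placed r p \<and> (\<forall>q. valid_next W placed r q \<longrightarrow> yx_lex_le p q)"
      using p by (auto simp: S_def)
    fix p' assume p': "valid_next W placed r p' \<and> (\<forall>q. valid_next W placed r q \<longrightarrow> yx_lex_le p' q)"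
    then have "yx_lex_le p' p" "yx_lex_le p p'" using p by (simp_all add: S_def del: split_paired_All)
    then show "p' = p" by (auto simp: yx_lex_le_def prod_eq_iff)
  qed
  then have "bl_next W placed r = p" using False by (simp add: bl_next_def)
  then show ?thesis using p by (auto simp: S_def)
qed

text \<open>Unrolls the recursion: each entry is computed from the prefix before it. The accumulator
  stays general for the induction.\<close>

lemma bl_go_append:
  "\<exists>L. bl_go W placed rs = placed @ L \<and> map snd L = rs \<and>
    (\<forall>i<length L. fst (L ! i) = bl_next W (placed @ take i L) (snd (L ! i)))"
proof (induction rs arbitrary: placed)
  case Nil
  then show ?case by simp
next
  case (Cons r rs)
  define e where "e = (bl_next W placed r, r)"
  obtain L where L: "bl_go W (placed @ [e]) rs = (placed @ [e]) @ L" "map snd L = rs"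
    "\<And>i. i < length L \<Longrightarrow> fst (L ! i) = bl_next W ((placed @ [e]) @ take i L) (snd (L ! i))"
    using Cons.IH[of "placed @ [e]"] by blast
  have "fst ((e # L) ! i) = bl_next W (placed @ take i (e # L)) (snd ((e # L) ! i))"
    if "i < length (e # L)" for i
    using that L(3) by (cases i) (auto simp: e_def)
  then show ?case using L by (intro exI[of _ "e # L"]) (auto simp: e_def)
qed

text \<open>The squares are indexed by their place in \<^term>\<open>rs\<close> rather than in the order \<^term>\<open>qs\<close>
  in which they are placed, so that one labelling serves all orders; the order survives as the
  time stamp \<^term>\<open>f\<close>.\<close>
lemma bl_go_bl_packing:
  assumes ss: "sspp_instance W ss" and perm: "mset qs = mset (squares ss)"
  obtains x y f where "bl_packing W {..<length ss} ((!) ss) x y f"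
    and "\<And>i. i < length ss \<Longrightarrow> y i + ss ! i \<le> h_bl W qs"
proof -
  let ?n = "length ss"
  obtain f where bij: "bij_betw f {..<?n} {..<length qs}"
    and f: "\<And>i. i < ?n \<Longrightarrow> squares ss ! i = qs ! f i"
    using permutation_Ex_bij[of "squares ss" qs] perm by (auto simp: squares_def)
  have sq: "squares ss ! i = (ss ! i, ss ! i)" if "i < ?n" for i
    using that by (simp add: squares_def)
  obtain L where go: "bl_go W [] qs = L" and L: "map snd L = qs"
    "\<And>i. i < length L \<Longrightarrow> fst (L ! i) = bl_next W (take i L) (snd (L ! i))"
    using bl_go_append[of W "[]" qs] by auto
  have len: "length L = length qs" using L(1) by auto
  have fL: "f i < length L" if "i < ?n" for i
    using bij_betwE[OF bij] that len by auto
  have sndL: "snd (L ! f i) = (ss ! i, ss ! i)" if "i < ?n" for i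
    using nth_map[OF fL[OF that], of snd] f[OF that] sq[OF that] L(1) by simp
  have pos: "0 < ss ! i" "ss ! i \<le> W" if "i < ?n" for i
    using that ss by (auto simp: sspp_instance_def)
  have pos_L: "0 < fst r \<and> 0 < snd r \<and> fst r \<le> W" if "(p, r) \<in> set L" for p r
  proof -
    have "r \<in> set qs" using that L(1) by force
    then have "r \<in> set (squares ss)" using perm mset_eq_setD by blast
    then show ?thesis using ss by (auto simp: squares_def sspp_instance_def)
  qed
  define X where "X i = fst (fst (L ! f i))" for i
  define Y where "Y i = snd (fst (L ! f i))" for i
  have L_eq: "L ! f i = ((X i, Y i), (ss ! i, ss ! i))" if "i < ?n" for i
    using sndL[OF that] by (auto simp: X_def Y_def prod_eq_iff)
  have min: "valid_next W (take (f i) L) (ss ! i, ss ! i) (X i, Y i) \<and>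
      (\<forall>q. valid_next W (take (f i) L) (ss ! i, ss ! i) q \<longrightarrow> yx_lex_le (X i, Y i) q)"
    if "i < ?n" for i
  proof -
    have "(X i, Y i) = bl_next W (take (f i) L) (ss ! i, ss ! i)"
      using L(2)[OF fL[OF that]] L_eq[OF that] by simp
    moreover have "0 < fst s \<and> 0 < snd s" if "(q, s) \<in> set (take (f i) L)" for q s
      using pos_L[of q s] in_set_takeD[OF that] by blast
    ultimately show ?thesis using bl_next_minimal[of "(ss ! i, ss ! i)" W "take (f i) L"] pos[OF that] by simp
  qed
  \<comment> \<open>Validity against a prefix of \<open>L\<close> is rewritten in terms of labels:
    the prefix consists of the squares with smaller time stamp.\<close>
  have valid_iff: "valid_next W (take (f i) L) (ss ! i, ss ! i) (u, v) \<longleftrightarrow>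
      0 \<le> u \<and> u + ss ! i \<le> W \<and> 0 \<le> v \<and> (\<forall>j<?n. f j < f i \<longrightarrow>
        X j + ss ! j \<le> u \<or> u + ss ! i \<le> X j \<or> Y j + ss ! j \<le> v \<or> v + ss ! i \<le> Y j)"
    if i: "i < ?n" for i u v
  proof -
    have "set (take (f i) L) = (\<lambda>j. L ! f j) ` {j. j < ?n \<and> f j < f i}"
    proof -
      have "set (take (f i) L) = (!) L ` {..<f i}"
        using fL[OF i] by (simp add: nth_image[symmetric] lessThan_atLeast0)
      also have "{..<f i} = f ` {j. j < ?n \<and> f j < f i}"
      proof
        show "{..<f i} \<subseteq> f ` {j. j < ?n \<and> f j < f i}"
        proof
          fix k assume k: "k \<in> {..<f i}"
          then have "k \<in> f ` {..<?n}" using bij fL[OF i] len by (auto simp: bij_betw_def)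
          then show "k \<in> f ` {j. j < ?n \<and> f j < f i}" using k by auto
        qed
      qed auto
      finally show ?thesis by (simp add: image_image)
    qed
    then have "(\<forall>(q, s)\<in>set (take (f i) L). open_rect q s \<inter> open_rect (u, v) (ss ! i, ss ! i) = {}) \<longleftrightarrow>
      (\<forall>j<?n. f j < f i \<longrightarrow> open_rect (X j, Y j) (ss ! j, ss ! j) \<inter> open_rect (u, v) (ss ! i, ss ! i) = {})"
      using L_eq by auto
    moreover have "open_rect (X j, Y j) (ss ! j, ss ! j) \<inter> open_rect (u, v) (ss ! i, ss ! i) = {} \<longleftrightarrow>
        X j + ss ! j \<le> u \<or> u + ss ! i \<le> X j \<or> Y j + ss ! j \<le> v \<or> v + ss ! i \<le> Y j"
      if "j < ?n" for j
      using pos[OF i] pos[OF that] by (simp add: open_rects_disjoint_iff)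
    ultimately show ?thesis by (simp add: valid_next_def in_strip_def)
  qed
  have inj: "inj_on f {..<?n}" using bij by (simp add: bij_betw_def)
  have "bl_packing W {..<?n} ((!) ss) X Y f"
  proof
    show "finite {..<?n}" "inj_on f {..<?n}" using inj by auto
    fix i assume "i \<in> {..<?n}"
    then have i: "i < ?n" by simp
    note v = min[OF i, THEN conjunct1, unfolded valid_iff[OF i]]
    show "0 < ss ! i" "0 \<le> X i" "X i + ss ! i \<le> W" "0 \<le> Y i" using pos[OF i] v by auto
    show "X i + ss ! i \<le> X j \<or> X j + ss ! j \<le> X i \<or> Y i + ss ! i \<le> Y j \<or> Y j + ss ! j \<le> Y i"
      if "j \<in> {..<?n}" "i \<noteq> j" for j
    proof -
      have j: "j < ?n" using that by simp
      have "f i \<noteq> f j" using inj i j that by (auto simp: inj_on_def)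
      \<comment> \<open>The later of the two squares was placed validly with respect to the earlier
        one.\<close>
      then consider "f j < f i" | "f i < f j" by linarith
      then show ?thesis
        using v i j min[OF j, THEN conjunct1, unfolded valid_iff[OF j]] by cases blast+
    qed
    show "Y i < v \<or> Y i = v \<and> X i \<le> u"
      if "0 \<le> u" "u + ss ! i \<le> W" "0 \<le> v"
        "\<And>j. j \<in> {..<?n} \<Longrightarrow> f j < f i \<Longrightarrow>
          X j + ss ! j \<le> u \<or> u + ss ! i \<le> X j \<or> Y j + ss ! j \<le> v \<or> v + ss ! i \<le> Y j" for u v
    proof -
      have "valid_next W (take (f i) L) (ss ! i, ss ! i) (u, v)"
        unfolding valid_iff[OF i] using that by auto
      then show ?thesis using min[OF i] by (auto simp: yx_lex_le_def)
    qed
  qed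
  moreover have "Y i + ss ! i \<le> h_bl W qs" if "i < ?n" for i
  proof -
    have "((X i, Y i), (ss ! i, ss ! i)) \<in> set L"
      using nth_mem[OF fL[OF that]] L_eq[OF that] by simp
    then show ?thesis unfolding h_bl_def go by (intro Max_ge) (auto intro!: rev_image_eqI)
  qed
  ultimately show thesis by (rule that)
qed

text \<open>Every feasible packing is at least as high as the first square. This bounds the set
  below, making its \<open>Inf\<close> meaningful, and keeps the later denominator positive.\<close>

lemma h_opt_le:
  assumes "sspp_instance W ss" "feasible_packing W (squares ss) pos"
  shows "h_opt W (squares ss) \<le> packing_height (squares ss) pos" "0 < h_opt W (squares ss)"
proof -
  have n: "0 < length (squares ss)" and s0: "0 < snd (squares ss ! 0)"
    using assms(1) by (auto simp: sspp_instance_def squares_def)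
  have lower: "snd (squares ss ! 0) \<le> packing_height (squares ss) p"
    if "feasible_packing W (squares ss) p" for p
  proof -
    have "0 + snd (squares ss ! 0) \<le> snd (p 0) + snd (squares ss ! 0)"
      using that n by (auto simp: feasible_packing_def in_strip_def)
    also have "\<dots> \<le> packing_height (squares ss) p"
      unfolding packing_height_def using n by (intro Max_ge) auto
    finally show ?thesis by simp
  qed
  show "h_opt W (squares ss) \<le> packing_height (squares ss) pos"
    unfolding h_opt_def using assms(2) lower by (intro cInf_lower bdd_belowI) auto
  have "snd (squares ss ! 0) \<le> h_opt W (squares ss)"
    unfolding h_opt_def using assms(2) lower by (intro cInf_greatest) auto
  then show "0 < h_opt W (squares ss)" using s0 by simp
qed

section \<open>The concrete instance and its ratio\<close>

definition hard_squares :: "real \<Rightarrow> real list" where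
  "hard_squares d = [2 - 3*d, 2 - 3*d, 2 + 2*d, 2 + 2*d, 1 + d] @ replicate 10 1"

lemma sspp_hard_squares:
  assumes "0 < d" "d \<le> 1/100"
  shows "sspp_instance (9 - d) (hard_squares d)"
  using assms by (auto simp: sspp_instance_def hard_squares_def)

lemma h_bl_hard_squares:
  assumes d: "0 < d" "d \<le> 1/100" and perm: "mset qs = mset (squares (hard_squares d))"
  shows "4 - 6*d \<le> h_bl (9 - d) qs"
proof -
  let ?ss = "hard_squares d"
  have len: "length ?ss = 15" by (simp add: hard_squares_def)
  obtain x y f where "bl_packing (9 - d) {..<length ?ss} ((!) ?ss) x y f"
    and h: "\<And>i. i < length ?ss \<Longrightarrow> y i + ?ss ! i \<le> h_bl (9 - d) qs"
    using bl_go_bl_packing[OF sspp_hard_squares[OF d] perm] by blast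
  then interpret bl_packing "9 - d" "{..<15}" "(!) ?ss" x y f by (simp add: len)
  have "\<exists>i\<in>{..<15}. 4 - 6*d \<le> y i + ?ss ! i"
  proof (rule tall_packing[where U = "{5..<15}", OF d refl])
    show "{..<15} = {0, 1, 2, 3, 4} \<union> {5..<15::nat}" by auto
    show "?ss ! i = 1" if "i \<in> {5..<15}" for i
      using that by (auto simp: hard_squares_def nth_append)
  qed (auto simp: hard_squares_def)
  then show ?thesis using h len by fastforce
qed

lemma h_opt_hard_squares:
  assumes d: "0 < d" "d \<le> 1/100"
  shows "h_opt (9 - d) (squares (hard_squares d)) \<le> 3 + 2*d"
    and "0 < h_opt (9 - d) (squares (hard_squares d))"
proof -
  let ?ss = "hard_squares d"
  \<comment> \<open>Three full rows of total height \<open>3 + 2*d\<close>: the second big pair and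
    \<open>z\<close> stand at height 1 on the floor units, and the last five units hang at the
    common height \<open>2 + 2*d\<close>, partly floating, as bottom-left would not place
    them.\<close>
  define P :: "point list" where "P = [(0, 0), (5, 1), (2 - 3*d, 0), (7 - 3*d, 1), (4 - d, 1)] @
    [(4 - d, 0), (5 - d, 0), (6 - d, 0), (7 - d, 0), (8 - d, 0)] @
    [(0, 2 + 2*d), (1, 2 + 2*d), (2, 2 + 2*d), (3, 2 + 2*d), (4, 2 + 2*d)]"
  have sq: "squares ?ss = [(2 - 3*d, 2 - 3*d), (2 - 3*d, 2 - 3*d), (2 + 2*d, 2 + 2*d), (2 + 2*d, 2 + 2*d),
    (1 + d, 1 + d), (1,1), (1,1), (1,1), (1,1), (1,1), (1,1), (1,1), (1,1), (1,1), (1,1)]"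
    by (simp add: squares_def hard_squares_def numeral_eq_Suc)
  have idx: "{..<15::nat} = {0,1,2,3,4,5,6,7,8,9,10,11,12,13,14}"
    by (rule set_eqI, simp only: lessThan_iff insert_iff empty_iff, arith)
  have len: "length (squares ?ss) = 15" by (simp add: sq)
  have feas: "feasible_packing (9 - d) (squares ?ss) ((!) P)"
  proof -
    have "\<forall>i\<in>{..<15}. in_strip (9 - d) (P ! i) (squares ?ss ! i)"
      unfolding idx sq P_def using d by (simp add: in_strip_def)
    \<comment> \<open>\<open>sorted_wrt\<close> checks each pair once; symmetry of intersection
      gives the rest.\<close>
    moreover have "sorted_wrt (\<lambda>(p, r) (q, s). open_rect p r \<inter> open_rect q s = {}) (zip P (squares ?ss))"
      unfolding sq P_def using d by (simp add: open_rects_disjoint_iff)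
    then have "open_rect (P ! i) (squares ?ss ! i) \<inter> open_rect (P ! j) (squares ?ss ! j) = {}"
      if "i < j" "j < 15" for i j
      using that len by (auto simp: sorted_wrt_iff_nth_less P_def)
    ultimately show ?thesis
      unfolding feasible_packing_def len by (metis Int_commute lessThan_iff linorder_neqE_nat)
  qed
  have "packing_height (squares ?ss) ((!) P) \<le> 3 + 2*d"
  proof -
    have "\<forall>i\<in>{..<15}. snd (P ! i) + snd (squares ?ss ! i) \<le> 3 + 2*d"
      unfolding idx sq P_def using d by simp
    then show ?thesis unfolding packing_height_def len by (subst Max_le_iff) (auto simp: lessThan_empty_iff)
  qed
  then show "h_opt (9 - d) (squares ?ss) \<le> 3 + 2*d" "0 < h_opt (9 - d) (squares ?ss)"
    using h_opt_le[OF sspp_hard_squares[OF d] feas] by auto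
qed

theorem theorem1:
  fixes \<epsilon> :: real
  assumes "\<epsilon> > 0"
  shows "\<exists>W ss. sspp_instance W ss \<and>
           h_bl_best W (squares ss) / h_opt W (squares ss) \<ge> 4/3 - \<epsilon>"
proof -
  \<comment> \<open>The choice \<open>\<epsilon> / 3\<close> suffices because
    \<open>(4 - 6*d) / (3 + 2*d)\<close> is at least \<open>4/3 - 3*d\<close>; the cap 1/100 is the
    smallness needed by the instance.\<close>
  define d where "d = min (\<epsilon> / 3) (1/100)"
  have d: "0 < d" "d \<le> 1/100" "3 * d \<le> \<epsilon>" using assms by (auto simp: d_def)
  let ?W = "9 - d" and ?rs = "squares (hard_squares d)"
  have opt: "h_opt ?W ?rs \<le> 3 + 2*d" "0 < h_opt ?W ?rs" using h_opt_hard_squares d by auto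
  have best: "4 - 6*d \<le> h_bl_best ?W ?rs"
    unfolding h_bl_best_def
  proof (rule Min.boundedI)
    show "finite (h_bl ?W ` {qs. mset qs = mset ?rs})" by (simp add: mset_eq_finite)
  qed (use h_bl_hard_squares d in auto)
  have "4/3 - \<epsilon> \<le> 4/3 - 3*d" using d by simp
  also have "\<dots> \<le> (4 - 6*d) / (3 + 2*d)"
    using d by (simp add: field_simps)
  also have "\<dots> \<le> h_bl_best ?W ?rs / h_opt ?W ?rs"
    using opt best d by (intro frac_le) auto
  finally show ?thesis using sspp_hard_squares d by blast
qed

end
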